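(* For every integer $n \ge 1$, the sum of the denominators of all fractions in the Farey sequence $F_n$ equals twice the sum of the numerators of all fractions in $F_n$. That is, if $N_n = \sum_{\frac{a}{b} \in F_n} a$ and $D_n = \sum_{\frac{a}{b}\in F_n} b$, where every fraction $\frac{a}{b}$ is written in reduced form, then $D_n = 2 N_n$.
   Context: For an integer $n\ge 1$, the Farey sequence $F_n$ (in the interval $[0,1]$) is the increasing finite sequence of all rational numbers in $[0,1]$ which, written in reduced form $\frac{a}{b}$ (with $a \ge 0$, $b\ge 1$, $\gcd(a,b)=1$), have denominator $b \le n$. It starts at $\frac{0}{1}$ and ends at $\frac{1}{1}$. For example, $F_1 = \left(\frac{0}{1},\frac{1}{1}\right)$ and $F_3=\left(\frac{0}{1},\frac{1}{3},\frac{1}{2},\frac{2}{3},\frac{1}{1}\right)$. *)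

theory Defs
  imports Complex_Main
begin

text \<open>
  \<^term>\<open>quotient_of x\<close> is the reduced form of the rational \<^term>\<open>x\<close>: the unique pair of
  coprime integers \<^term>\<open>(a, b)\<close> with \<^prop>\<open>b > 0\<close> and \<^term>\<open>x\<close> equal to the fraction a/b.
\<close>

definition numerator :: "rat \<Rightarrow> int" where
  "numerator x = fst (quotient_of x)"

definition denominator :: "rat \<Rightarrow> int" where
  "denominator x = snd (quotient_of x)"

definition farey_set :: "nat \<Rightarrow> rat set" where
  "farey_set n = {x. 0 \<le> x \<and> x \<le> 1 \<and> denominator x \<le> int n}"

text \<open>
  \<^const>\<open>sorted_list_of_set\<close> returns the empty list on infinite sets; this case does not arise,
  by \<open>finite_farey_set\<close> below.
\<close>

definition farey :: "nat \<Rightarrow> rat list" where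
  "farey n = sorted_list_of_set (farey_set n)"

lemma finite_farey_set: "finite (farey_set n)"
proof (rule finite_subset)
  show "farey_set n \<subseteq> (\<lambda>(a, b). Fract a b) ` ({0..int n} \<times> {0..int n})"
  proof
    fix x assume x: "x \<in> farey_set n"
    obtain a b where ab: "quotient_of x = (a, b)" by (cases "quotient_of x")
    have b: "b > 0" using ab by (rule quotient_of_denom_pos)
    have eq: "x = Fract a b"
      using quotient_of_div[OF ab] by (simp add: Fract_of_int_quotient)
    have "b \<le> int n" "0 \<le> a" "a \<le> b"
      using x b ab unfolding eq farey_set_def denominator_def
      by (auto simp: zero_le_Fract_iff Fract_le_one_iff)
    then show "x \<in> (\<lambda>(a, b). Fract a b) ` ({0..int n} \<times> {0..int n})"
      using eq b by (intro image_eqI[where x = "(a, b)"]) auto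
  qed
qed simp

lemma set_farey: "set (farey n) = farey_set n"
  by (simp add: farey_def finite_farey_set)

lemma farey_increasing: "sorted_wrt (<) (farey n)"
  by (simp add: farey_def)

end

theory Submission
  imports Defs
begin

text \<open>
  The reflection \<open>x \<mapsto> 1 - x\<close> permutes the Farey fractions and sends the reduced fraction
  \<open>a/b\<close> to the reduced fraction \<open>(b - a)/b\<close>; hence the numerator sum \<open>N\<close> and the denominator
  sum \<open>D\<close> satisfy \<open>N = D - N\<close>.
\<close>

text \<open>Since gcd(b - a, b) = gcd(a, b) = 1 and b > 0, the fraction (b - a)/b is already in
  lowest terms, so normalization leaves the pair unchanged.\<close>

lemma quotient_of_one_minus:
  assumes "quotient_of x = (a, b)"
  shows "quotient_of (1 - x) = (b - a, b)"
proof -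
  have b: "b > 0" and cop: "coprime a b"
    using assms by (rule quotient_of_denom_pos, rule quotient_of_coprime)
  have "coprime (b - a) b"
    using cop by (metis coprime_iff_gcd_eq_1 gcd.commute gcd_diff1 gcd_diff2)
  moreover have "1 - x = Fract (b - a) b"
    using b quotient_of_div[OF assms] by (simp add: Fract_of_int_quotient diff_divide_distrib)
  ultimately show ?thesis
    using b by (simp add: quotient_of_Fract normalize_stable)
qed

lemma denominator_one_minus: "denominator (1 - x) = denominator x"
  by (cases "quotient_of x") (simp add: denominator_def quotient_of_one_minus)

lemma numerator_one_minus: "numerator (1 - x) = denominator x - numerator x"
  by (cases "quotient_of x") (simp add: numerator_def denominator_def quotient_of_one_minus)

lemma one_minus_in_farey_set: "x \<in> farey_set n \<Longrightarrow> 1 - x \<in> farey_set n"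
  by (simp add: farey_set_def denominator_one_minus)

text \<open>The list has no repeated entries. Sums over the set can be reindexed along a
  bijection.\<close>

lemma sum_list_farey: "(\<Sum>x\<leftarrow>farey n. f x) = (\<Sum>x\<in>farey_set n. f x)"
  by (metis distinct_sorted_list_of_set farey_def set_farey sum_list_distinct_conv_sum_set)

theorem theorem2p4:
  fixes n :: nat
  assumes "n \<ge> 1"
  shows "(\<Sum>x\<leftarrow>farey n. denominator x) = 2 * (\<Sum>x\<leftarrow>farey n. numerator x)"
proof -
  have "(\<Sum>x\<in>farey_set n. numerator x) = (\<Sum>x\<in>farey_set n. numerator (1 - x))"
    \<comment> \<open>The reflection is an involution, so it serves as both the map and its
      inverse.\<close>
    by (rule sum.reindex_bij_witness[where i = "\<lambda>x. 1 - x" and j = "\<lambda>x. 1 - x"])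
      (simp_all add: one_minus_in_farey_set)
  also have "\<dots> = (\<Sum>x\<in>farey_set n. denominator x) - (\<Sum>x\<in>farey_set n. numerator x)"
    by (simp add: numerator_one_minus sum_subtractf)
  finally show ?thesis
    by (simp add: sum_list_farey)
qed

end
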